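(* Consider two scalar ($K=1$) $\mathcal{SL}$-BSDEs with terminal conditions $Q,\bar Q$, drivers $F,\bar F$ and solutions $(Y,Z,Z')$, $(\bar Y,\bar Z,\bar Z')$. Suppose that (i) $Q\ge\bar Q$ q.s.; (ii) $F(t,y,z,z')\ge\bar F(t,y,z,z')$ q.s. for all $t,y,z,z'$; (iii) $y\mapsto y-F(t,y,z,z')$ is strictly increasing as a function of $y$, for all $t,z,z'$; (iv) for all $t,y$ and all $(z,z')\ne(\bar z,\bar z')$, $$F(t,y,z,z')-F(t,y,\bar z,\bar z')+G_t(z')-G_t(\bar z')>\min_{\mathcal{F}_t}\{(z-\bar z)M_{t+1}+(z'-\bar z')N_{t+1}\}\quad\text{q.s.}$$ Then $Y_t\ge\bar Y_t$ (q.s.) for all $t$. Furthermore, strict comparison holds: if for some $A\in\mathcal{F}_t$, $Y_t=\bar Y_t$ on $A$, then $Q=\bar Q$ on $A$ (q.s.).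
   Context: Finite-state setting. $\mathcal{X}=(\mathcal{X}_t)$ is a discrete-time process taking values in the standard basis vectors of $\mathbb{R}^N$, $\mathbb{X}_t=\sum_{u=1}^t\mathcal{X}_u$, and $\mathcal{F}_t=\sigma(\mathcal{X}_1,\dots,\mathcal{X}_t)$ ($\mathcal{F}_0$ trivial), $\mathcal{F}=\mathcal{F}_\infty=\sigma(\bigcup_t\mathcal{F}_t)$. $^*$ denotes transpose. $m\mathcal{F}_t$ denotes the $\mathcal{F}_t$-measurable $\mathbb{R}\cup\{\pm\infty\}$-valued functions. $\mathcal{H}$ is a linear space of $\mathcal{F}$-measurable $\mathbb{R}$-valued functions on $\Omega$ containing the constants, with $|X|\in\mathcal{H}$ and $I_AX\in\mathcal{H}$ whenever $X\in\mathcal{H}$, $A\in\mathcal{F}$; $\mathcal{H}_t=\mathcal{H}\cap m\mathcal{F}_t$. $\mathcal{E}$ is an $\mathcal{SL}$-expectation: a family of maps $\mathcal{E}_t:\mathcal{H}\to\mathcal{H}_t$ such that for all $X,Y\in\mathcal{H}$, $s\le t$: (i) $X\ge Y$ implies $\mathcal{E}_t(X)\ge\mathcal{E}_t(Y)$; (ii) $\mathcal{E}_s(Y)=\mathcal{E}_s(\mathcal{E}_t(Y))$; (iii) $\mathcal{E}_t(I_AY)=I_A\mathcal{E}_t(Y)$ for $A\in\mathcal{F}_t$; (iv) $\mathcal{E}_t(Y)=Y$ for $Y\in\mathcal{H}_t$; (v) $\mathcal{E}_t(X+Y)\le\mathcal{E}_t(X)+\mathcal{E}_t(Y)$; (vi)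 $\mathcal{E}_t(\lambda Y)=\lambda^+\mathcal{E}_t(Y)+\lambda^-\mathcal{E}_t(-Y)$ for $\lambda\in\mathcal{H}_t$ with $\lambda Y\in\mathcal{H}$; (vii) if $X_i\in\mathcal{H}$ and $X_i(\omega)\downarrow0$ for every $\omega$, then $\mathcal{E}_0(X_i)\to0$. Write $\mathcal{E}=\mathcal{E}_0$. A set $A$ is polar if $\mathcal{E}(I_A)=0$; a statement holds quasi-surely (q.s.) if it holds outside a polar set. $L^1(\mathcal{F})$ is the completion of $\{X\in\mathcal{H}:\mathcal{E}(|X|)<\infty\}$ under $\|X\|_1=\mathcal{E}(|X|)$ (modulo equality in $\|\cdot\|_1$), $L^1(\mathcal{F}_t)=L^1(\mathcal{F})\cap m\mathcal{F}_t$, and $\mathcal{E}_t$ extends to $L^1$ by continuity. An $\mathcal{SL}$-martingale is an adapted $L^1$ process with $X_s=\mathcal{E}_s(X_t)$ for $s\le t$; it is symmetric if $\mathcal{E}_s(X_t)=-\mathcal{E}_s(-X_t)$ for all $s,t$ (componentwise for vectors). Fix an invertible adapted bounded linear map $\Phi_u:\mathbb{R}^N\to\mathbb{R}^N$, represented by premultiplication by the matrix $[\mathbf{1}|(\phi^s_u)^*|(\phi'_u)^*]^*$, where $\mathbf{1}$ is a column of 1's, $\phi^s_u$ is an $M\times N$ matrix for some $0\le M\le N-1$, $\phi'_u$ is an $(N-M-1)\times N$ matrix, and $\sum_{0\le u<t}\phi^s_u(\mathbb{X}_{u+1}-\mathbb{X}_u)$ is a symmetric $\mathcal{SL}$-martingale.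 Set $M_{t+1}=\phi^s_t(\mathbb{X}_{t+1}-\mathbb{X}_t)$, $N_{t+1}=\phi'_t(\mathbb{X}_{t+1}-\mathbb{X}_t)$ and $G_t(z)=\mathcal{E}_t(zN_{t+1})$. $T$ is a finite deterministic time. A (scalar) driver is a map $F:\Omega\times\{0,\dots,T-1\}\times\mathbb{R}\times\mathbb{R}^{1\times M}\times\mathbb{R}^{1\times(N-M-1)}\to\mathbb{R}$ with $F(\cdot,t,y,z,z')\in L^1(\mathcal{F}_t)$ for all $t,y,z,z'$ (the argument $\omega$ is omitted). The $\mathcal{SL}$-BSDE with driver $F$ and terminal condition $Q\in L^1(\mathcal{F}_T)$ is $$Y_{t+1}=Y_t-F(\omega,t,Y_t,Z_t,Z'_t)+Z_tM_{t+1}+Z'_tN_{t+1}-G_t(Z'_t),\quad 0\le t<T,\qquad Y_T=Q;$$ a solution is a triple $(Y,Z,Z')$ of adapted processes (of appropriate dimension) satisfying it. $\min_{\mathcal{F}_t}$ denotes the essential minimum conditional on $\mathcal{F}_t$, i.e. the minimum over all non-polar paths of the state-tree extending from the current (time-$t$) node. *)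

theory Defs
  imports "HOL-Analysis.Borel_Space" "Jordan_Normal_Form.Matrix"
begin

text \<open>
  The sample space is the universe of the type \<open>'a\<close>.  Vectors and matrices are those of
  \<open>Jordan_Normal_Form\<close>, whose dimensions are natural numbers and may be \<open>0\<close>.
  A row vector \<open>z\<close> is a \<open>real vec\<close>, and its product with a column is the scalar product.
  In the process \<open>\<X>\<close> the value at time \<open>0\<close> is never used.
\<close>

text \<open>The \<open>\<sigma>\<close>-algebras \<open>\<F>\<^sub>t\<close> and \<open>\<F>\<close>. As \<open>\<X>\<close> takes finitely many values,
  the preimages of points generate \<open>\<sigma>(\<X>\<^sub>1, \<dots>, \<X>\<^sub>t)\<close>.\<close>

definition filt :: "(nat \<Rightarrow> 'a \<Rightarrow> real vec) \<Rightarrow> nat \<Rightarrow> 'a measure" where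
  "filt \<X> t = sigma UNIV {\<X> u -` {v} | u v. 1 \<le> u \<and> u \<le> t}"

definition filt_inf :: "(nat \<Rightarrow> 'a \<Rightarrow> real vec) \<Rightarrow> 'a measure" where
  "filt_inf \<X> = sigma UNIV (\<Union>t. sets (filt \<X> t))"

definition cumul :: "nat \<Rightarrow> (nat \<Rightarrow> 'a \<Rightarrow> real vec) \<Rightarrow> nat \<Rightarrow> 'a \<Rightarrow> real vec" where
  "cumul N \<X> t \<omega> = vec N (\<lambda>i. \<Sum>u = 1..t. vec_index (\<X> u \<omega>) i)"

definition Ht :: "(nat \<Rightarrow> 'a \<Rightarrow> real vec) \<Rightarrow> ('a \<Rightarrow> real) set \<Rightarrow> nat \<Rightarrow> ('a \<Rightarrow> real) set" where
  "Ht \<X> H t = H \<inter> borel_measurable (filt \<X> t)"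

locale sl_expectation =
  fixes N :: nat
    and \<X> :: "nat \<Rightarrow> 'a \<Rightarrow> real vec"
    and H :: "('a \<Rightarrow> real) set"
    and E :: "nat \<Rightarrow> ('a \<Rightarrow> real) \<Rightarrow> 'a \<Rightarrow> real"
  assumes basis_valued: "\<And>t \<omega>. 1 \<le> t \<Longrightarrow> \<X> t \<omega> \<in> set (unit_vecs N)"
    and H_measurable: "H \<subseteq> borel_measurable (filt_inf \<X>)"
    and H_const: "\<And>c. (\<lambda>_. c) \<in> H"
    and H_add: "\<And>X Y. X \<in> H \<Longrightarrow> Y \<in> H \<Longrightarrow> (\<lambda>\<omega>. X \<omega> + Y \<omega>) \<in> H"
    and H_scale: "\<And>c X. X \<in> H \<Longrightarrow> (\<lambda>\<omega>. c * X \<omega>) \<in> H"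
    and H_abs: "\<And>X. X \<in> H \<Longrightarrow> (\<lambda>\<omega>. \<bar>X \<omega>\<bar>) \<in> H"
    and H_indicator: "\<And>X A. X \<in> H \<Longrightarrow> A \<in> sets (filt_inf \<X>) \<Longrightarrow>
          (\<lambda>\<omega>. indicat_real A \<omega> * X \<omega>) \<in> H"
    and E_maps: "\<And>t X. X \<in> H \<Longrightarrow> E t X \<in> Ht \<X> H t"
    and E_mono: "\<And>t X Y \<omega>. X \<in> H \<Longrightarrow> Y \<in> H \<Longrightarrow> (\<And>\<omega>'. Y \<omega>' \<le> X \<omega>') \<Longrightarrow>
          E t Y \<omega> \<le> E t X \<omega>"
    and E_tower: "\<And>s t Y. Y \<in> H \<Longrightarrow> s \<le> t \<Longrightarrow> E s Y = E s (E t Y)"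
    and E_local: "\<And>t A Y. Y \<in> H \<Longrightarrow> A \<in> sets (filt \<X> t) \<Longrightarrow>
          E t (\<lambda>\<omega>. indicat_real A \<omega> * Y \<omega>) = (\<lambda>\<omega>. indicat_real A \<omega> * E t Y \<omega>)"
    and E_adapted: "\<And>t Y. Y \<in> Ht \<X> H t \<Longrightarrow> E t Y = Y"
    and E_subadd: "\<And>t X Y \<omega>. X \<in> H \<Longrightarrow> Y \<in> H \<Longrightarrow>
          E t (\<lambda>\<omega>. X \<omega> + Y \<omega>) \<omega> \<le> E t X \<omega> + E t Y \<omega>"
    and E_scale: "\<And>t l Y \<omega>. Y \<in> H \<Longrightarrow> l \<in> Ht \<X> H t \<Longrightarrow> (\<lambda>\<omega>. l \<omega> * Y \<omega>) \<in> H \<Longrightarrow>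
          E t (\<lambda>\<omega>. l \<omega> * Y \<omega>) \<omega>
            = max (l \<omega>) 0 * E t Y \<omega> + max (- l \<omega>) 0 * E t (\<lambda>\<omega>. - Y \<omega>) \<omega>"
    and E_continuous: "\<And>X \<omega>. (\<And>i. X i \<in> H) \<Longrightarrow>
          (\<And>\<omega>'. decseq (\<lambda>i. X i \<omega>') \<and> (\<lambda>i. X i \<omega>') \<longlonglongrightarrow> 0) \<Longrightarrow>
          (\<lambda>i. E 0 (X i) \<omega>) \<longlonglongrightarrow> 0"

text \<open>\<open>E 0 X\<close> is a constant function because \<open>\<F>\<^sub>0\<close> is trivial.\<close>

definition polar ::
  "(nat \<Rightarrow> 'a \<Rightarrow> real vec) \<Rightarrow> (nat \<Rightarrow> ('a \<Rightarrow> real) \<Rightarrow> 'a \<Rightarrow> real) \<Rightarrow> 'a set \<Rightarrow> bool" where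
  "polar \<X> E A \<longleftrightarrow> A \<in> sets (filt_inf \<X>) \<and> E 0 (indicat_real A) = (\<lambda>_. 0)"

definition qs ::
  "(nat \<Rightarrow> 'a \<Rightarrow> real vec) \<Rightarrow> (nat \<Rightarrow> ('a \<Rightarrow> real) \<Rightarrow> 'a \<Rightarrow> real) \<Rightarrow> ('a \<Rightarrow> bool) \<Rightarrow> bool" where
  "qs \<X> E P \<longleftrightarrow> (\<exists>A. polar \<X> E A \<and> (\<forall>\<omega>. \<omega> \<notin> A \<longrightarrow> P \<omega>))"

text \<open>
  Members of \<open>L\<^sup>1\<close> are represented by functions: an element of the completion is the class of a
  \<open>\<parallel>\<cdot>\<parallel>\<^sub>1\<close>-Cauchy sequence in \<open>H\<close>, and every such sequence has a subsequence converging
  quasi-surely (by continuity from above); the quasi-sure limit determines the class, and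
  equality in \<open>\<parallel>\<cdot>\<parallel>\<^sub>1\<close> is quasi-sure equality. \<open>L1_lim f X\<close> says that \<open>f\<close> is such a sequence
  representing \<open>X\<close>. The condition \<open>\<E>(|X|) < \<infinity>\<close> holds for every \<open>X \<in> H\<close>, since \<open>E\<close> is real valued.
\<close>

definition L1_lim ::
  "(nat \<Rightarrow> 'a \<Rightarrow> real vec) \<Rightarrow> ('a \<Rightarrow> real) set \<Rightarrow> (nat \<Rightarrow> ('a \<Rightarrow> real) \<Rightarrow> 'a \<Rightarrow> real)
    \<Rightarrow> (nat \<Rightarrow> 'a \<Rightarrow> real) \<Rightarrow> ('a \<Rightarrow> ereal) \<Rightarrow> bool" where
  "L1_lim \<X> H E f X \<longleftrightarrow>
     X \<in> borel_measurable (filt_inf \<X>) \<and>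
     (\<forall>n. f n \<in> H) \<and>
     (\<forall>e>0. \<exists>n\<^sub>0. \<forall>m\<ge>n\<^sub>0. \<forall>n\<ge>n\<^sub>0. \<forall>\<omega>. E 0 (\<lambda>\<omega>'. \<bar>f m \<omega>' - f n \<omega>'\<bar>) \<omega> < e) \<and>
     qs \<X> E (\<lambda>\<omega>. (\<lambda>n. ereal (f n \<omega>)) \<longlonglongrightarrow> X \<omega>)"

definition L1 ::
  "(nat \<Rightarrow> 'a \<Rightarrow> real vec) \<Rightarrow> ('a \<Rightarrow> real) set \<Rightarrow> (nat \<Rightarrow> ('a \<Rightarrow> real) \<Rightarrow> 'a \<Rightarrow> real)
    \<Rightarrow> ('a \<Rightarrow> ereal) set" where
  "L1 \<X> H E = {X. \<exists>f. L1_lim \<X> H E f X}"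

definition L1t ::
  "(nat \<Rightarrow> 'a \<Rightarrow> real vec) \<Rightarrow> ('a \<Rightarrow> real) set \<Rightarrow> (nat \<Rightarrow> ('a \<Rightarrow> real) \<Rightarrow> 'a \<Rightarrow> real)
    \<Rightarrow> nat \<Rightarrow> ('a \<Rightarrow> ereal) set" where
  "L1t \<X> H E t = L1 \<X> H E \<inter> borel_measurable (filt \<X> t)"

text \<open>\<open>L1_cond t X V\<close>: \<open>V\<close> represents the value at \<open>X\<close> of the continuous extension of \<open>\<E>\<^sub>t\<close>
  to \<open>L\<^sup>1\<close>; this value is unique up to quasi-sure equality.\<close>

definition L1_cond ::
  "(nat \<Rightarrow> 'a \<Rightarrow> real vec) \<Rightarrow> ('a \<Rightarrow> real) set \<Rightarrow> (nat \<Rightarrow> ('a \<Rightarrow> real) \<Rightarrow> 'a \<Rightarrow> real)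
    \<Rightarrow> nat \<Rightarrow> ('a \<Rightarrow> ereal) \<Rightarrow> ('a \<Rightarrow> ereal) \<Rightarrow> bool" where
  "L1_cond \<X> H E t X V \<longleftrightarrow>
     (\<exists>f. L1_lim \<X> H E f X \<and> L1_lim \<X> H E (\<lambda>n. E t (f n)) V)"

definition sl_martingale ::
  "(nat \<Rightarrow> 'a \<Rightarrow> real vec) \<Rightarrow> ('a \<Rightarrow> real) set \<Rightarrow> (nat \<Rightarrow> ('a \<Rightarrow> real) \<Rightarrow> 'a \<Rightarrow> real)
    \<Rightarrow> (nat \<Rightarrow> 'a \<Rightarrow> ereal) \<Rightarrow> bool" where
  "sl_martingale \<X> H E S \<longleftrightarrow>
     (\<forall>t. S t \<in> L1t \<X> H E t) \<and> (\<forall>s t. s \<le> t \<longrightarrow> L1_cond \<X> H E s (S t) (S s))"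

definition symmetric_sl_martingale ::
  "(nat \<Rightarrow> 'a \<Rightarrow> real vec) \<Rightarrow> ('a \<Rightarrow> real) set \<Rightarrow> (nat \<Rightarrow> ('a \<Rightarrow> real) \<Rightarrow> 'a \<Rightarrow> real)
    \<Rightarrow> (nat \<Rightarrow> 'a \<Rightarrow> ereal) \<Rightarrow> bool" where
  "symmetric_sl_martingale \<X> H E S \<longleftrightarrow>
     sl_martingale \<X> H E S \<and>
     (\<forall>s t. \<exists>V. L1_cond \<X> H E s (S t) V \<and> L1_cond \<X> H E s (\<lambda>\<omega>. - S t \<omega>) (\<lambda>\<omega>. - V \<omega>))"

definition adapted_vec ::
  "(nat \<Rightarrow> 'a \<Rightarrow> real vec) \<Rightarrow> nat \<Rightarrow> nat \<Rightarrow> ('a \<Rightarrow> real vec) \<Rightarrow> bool" where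
  "adapted_vec \<X> k t z \<longleftrightarrow>
     (\<forall>\<omega>. z \<omega> \<in> carrier_vec k) \<and>
     (\<forall>i<k. (\<lambda>\<omega>. vec_index (z \<omega>) i) \<in> borel_measurable (filt \<X> t))"

definition Phi ::
  "nat \<Rightarrow> (nat \<Rightarrow> 'a \<Rightarrow> real mat) \<Rightarrow> (nat \<Rightarrow> 'a \<Rightarrow> real mat) \<Rightarrow> nat \<Rightarrow> 'a \<Rightarrow> real mat" where
  "Phi N \<phi>s \<phi>' u \<omega> = mat 1 N (\<lambda>_. 1) @\<^sub>r \<phi>s u \<omega> @\<^sub>r \<phi>' u \<omega>"

text \<open>\<open>incr N \<X> \<phi> t\<close> is \<open>\<phi>\<^sub>t (\<XX>\<^sub>t\<^sub>+\<^sub>1 - \<XX>\<^sub>t)\<close>: the increment \<open>M\<^sub>t\<^sub>+\<^sub>1\<close> for \<open>\<phi> = \<phi>s\<close> and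
  \<open>N\<^sub>t\<^sub>+\<^sub>1\<close> for \<open>\<phi> = \<phi>'\<close>, indexed by \<open>t\<close> rather than \<open>t + 1\<close>.\<close>

definition incr ::
  "nat \<Rightarrow> (nat \<Rightarrow> 'a \<Rightarrow> real vec) \<Rightarrow> (nat \<Rightarrow> 'a \<Rightarrow> real mat) \<Rightarrow> nat \<Rightarrow> 'a \<Rightarrow> real vec" where
  "incr N \<X> \<phi> t \<omega> = \<phi> t \<omega> *\<^sub>v (cumul N \<X> (Suc t) \<omega> - cumul N \<X> t \<omega>)"

locale sl_basis = sl_expectation N \<X> H E
  for N :: nat
    and \<X> :: "nat \<Rightarrow> 'a \<Rightarrow> real vec"
    and H :: "('a \<Rightarrow> real) set"
    and E :: "nat \<Rightarrow> ('a \<Rightarrow> real) \<Rightarrow> 'a \<Rightarrow> real" +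
  fixes M :: nat
    and \<phi>s :: "nat \<Rightarrow> 'a \<Rightarrow> real mat"
    and \<phi>' :: "nat \<Rightarrow> 'a \<Rightarrow> real mat"
  assumes M_less: "M < N"
    and phis_dim: "\<And>u \<omega>. \<phi>s u \<omega> \<in> carrier_mat M N"
    and phi'_dim: "\<And>u \<omega>. \<phi>' u \<omega> \<in> carrier_mat (N - M - 1) N"
    and Phi_invertible: "\<And>u \<omega>. invertible_mat (Phi N \<phi>s \<phi>' u \<omega>)"
    and Phi_adapted: "\<And>u i j. i < N \<Longrightarrow> j < N \<Longrightarrow>
          (\<lambda>\<omega>. Phi N \<phi>s \<phi>' u \<omega> $$ (i, j)) \<in> borel_measurable (filt \<X> u)"
    and Phi_bounded: "\<And>u. \<exists>C. \<forall>\<omega>. \<forall>i<N. \<forall>j<N. \<bar>Phi N \<phi>s \<phi>' u \<omega> $$ (i, j)\<bar> \<le> C"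
    and phis_symmetric: "\<And>i. i < M \<Longrightarrow>
          symmetric_sl_martingale \<X> H E (\<lambda>t \<omega>. ereal (\<Sum>u<t. vec_index (incr N \<X> \<phi>s u \<omega>) i))"

text \<open>\<open>G\<^sub>t(z)\<close> for a random row vector \<open>z\<close>.\<close>

definition Gt ::
  "nat \<Rightarrow> (nat \<Rightarrow> 'a \<Rightarrow> real vec) \<Rightarrow> (nat \<Rightarrow> ('a \<Rightarrow> real) \<Rightarrow> 'a \<Rightarrow> real)
    \<Rightarrow> (nat \<Rightarrow> 'a \<Rightarrow> real mat) \<Rightarrow> nat \<Rightarrow> ('a \<Rightarrow> real vec) \<Rightarrow> 'a \<Rightarrow> real" where
  "Gt N \<X> E \<phi>' t z = E t (\<lambda>\<omega>. scalar_prod (z \<omega>) (incr N \<X> \<phi>' t \<omega>))"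

text \<open>\<open>node \<X> t \<omega>\<close> is the time-\<open>t\<close> node of the state-tree through which the path of \<open>\<omega>\<close> passes.
  For an \<open>\<F>\<^sub>s\<close>-measurable \<open>X\<close>, \<open>cond_ess_min \<X> E t s X \<omega>\<close> is the minimum of \<open>X\<close> over the
  non-polar paths of length \<open>s\<close> that extend this node. Paths have finite length here because
  single infinite paths may all be polar. At a polar node the set below is empty
  and the value is unspecified.\<close>

definition node :: "(nat \<Rightarrow> 'a \<Rightarrow> real vec) \<Rightarrow> nat \<Rightarrow> 'a \<Rightarrow> 'a set" where
  "node \<X> t \<omega> = {\<omega>'. \<forall>u. 1 \<le> u \<and> u \<le> t \<longrightarrow> \<X> u \<omega>' = \<X> u \<omega>}"

definition cond_ess_min ::
  "(nat \<Rightarrow> 'a \<Rightarrow> real vec) \<Rightarrow> (nat \<Rightarrow> ('a \<Rightarrow> real) \<Rightarrow> 'a \<Rightarrow> real) \<Rightarrow> nat \<Rightarrow> nat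
    \<Rightarrow> ('a \<Rightarrow> real) \<Rightarrow> 'a \<Rightarrow> real" where
  "cond_ess_min \<X> E t s X \<omega> = Min (X ` {\<omega>' \<in> node \<X> t \<omega>. \<not> polar \<X> E (node \<X> s \<omega>')})"

type_synonym 'a driver = "'a \<Rightarrow> nat \<Rightarrow> real \<Rightarrow> real vec \<Rightarrow> real vec \<Rightarrow> real"

definition is_driver ::
  "nat \<Rightarrow> (nat \<Rightarrow> 'a \<Rightarrow> real vec) \<Rightarrow> ('a \<Rightarrow> real) set \<Rightarrow> (nat \<Rightarrow> ('a \<Rightarrow> real) \<Rightarrow> 'a \<Rightarrow> real)
    \<Rightarrow> nat \<Rightarrow> nat \<Rightarrow> 'a driver \<Rightarrow> bool" where
  "is_driver N \<X> H E M T F \<longleftrightarrow>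
     (\<forall>t<T. \<forall>y. \<forall>z\<in>carrier_vec M. \<forall>z'\<in>carrier_vec (N - M - 1).
        (\<lambda>\<omega>. ereal (F \<omega> t y z z')) \<in> L1t \<X> H E t)"

definition is_solution ::
  "nat \<Rightarrow> (nat \<Rightarrow> 'a \<Rightarrow> real vec) \<Rightarrow> (nat \<Rightarrow> ('a \<Rightarrow> real) \<Rightarrow> 'a \<Rightarrow> real)
    \<Rightarrow> nat \<Rightarrow> (nat \<Rightarrow> 'a \<Rightarrow> real mat) \<Rightarrow> (nat \<Rightarrow> 'a \<Rightarrow> real mat) \<Rightarrow> nat
    \<Rightarrow> 'a driver \<Rightarrow> ('a \<Rightarrow> ereal)
    \<Rightarrow> (nat \<Rightarrow> 'a \<Rightarrow> real) \<Rightarrow> (nat \<Rightarrow> 'a \<Rightarrow> real vec) \<Rightarrow> (nat \<Rightarrow> 'a \<Rightarrow> real vec) \<Rightarrow> bool" where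
  "is_solution N \<X> E M \<phi>s \<phi>' T F Q Y Z Z' \<longleftrightarrow>
     (\<forall>t\<le>T. Y t \<in> borel_measurable (filt \<X> t)) \<and>
     (\<forall>t<T. adapted_vec \<X> M t (Z t)) \<and>
     (\<forall>t<T. adapted_vec \<X> (N - M - 1) t (Z' t)) \<and>
     (\<forall>t<T. qs \<X> E (\<lambda>\<omega>. Y (Suc t) \<omega> =
        Y t \<omega> - F \<omega> t (Y t \<omega>) (Z t \<omega>) (Z' t \<omega>)
          + scalar_prod (Z t \<omega>) (incr N \<X> \<phi>s t \<omega>)
          + scalar_prod (Z' t \<omega>) (incr N \<X> \<phi>' t \<omega>)
          - Gt N \<X> E \<phi>' t (Z' t) \<omega>)) \<and>
     qs \<X> E (\<lambda>\<omega>. ereal (Y T \<omega>) = Q \<omega>)"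

end

theory Submission
  imports Defs
begin

text \<open>
  There are finitely many nodes at each time and \<open>\<F>\<^sub>t\<close>-measurable functions are constant on
  time-\<open>t\<close> nodes, so a quasi-sure statement about \<open>\<F>\<^sub>t\<close>-measurable quantities is a pointwise one at
  the non-polar nodes. At such a node, with \<open>Y\<^sub>t = y\<close> and \<open>Yb\<^sub>t = yb\<close>, take a non-polar child at
  which \<open>(z - zb) M + (z' - zb') N\<close> attains its minimum. There the two equations and
  \<open>Y\<^sub>t\<^sub>+\<^sub>1 \<ge> Yb\<^sub>t\<^sub>+\<^sub>1\<close>, \<open>F \<ge> Fb\<close>, together with the balance condition at \<open>yb\<close>, give
  \<open>y - F(y, z, z') \<ge> yb - F(yb, z, z')\<close>, hence \<open>y \<ge> yb\<close>. If \<open>y = yb\<close>, the balance condition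
  cannot be strict, so \<open>(z, z') = (zb, zb')\<close> and \<open>Y\<^sub>t\<^sub>+\<^sub>1 - Yb\<^sub>t\<^sub>+\<^sub>1 = Fb - F \<le> 0\<close> at every child.
\<close>

section \<open>Nodes of the state-tree and maps that are constant on them\<close>

text \<open>Stands in for measurability with respect to \<open>filt \<X> t\<close>. It asks for no
  sigma-algebra on the target, so it also covers vectors, matrices and predicates.\<close>

definition nodewise :: "(nat \<Rightarrow> 'a \<Rightarrow> real vec) \<Rightarrow> nat \<Rightarrow> ('a \<Rightarrow> 'b) \<Rightarrow> bool" where
  "nodewise \<X> t f \<longleftrightarrow> (\<forall>\<omega> \<omega>'. \<omega>' \<in> node \<X> t \<omega> \<longrightarrow> f \<omega>' = f \<omega>)"

lemma nodewiseD: "nodewise \<X> t f \<Longrightarrow> \<omega>' \<in> node \<X> t \<omega> \<Longrightarrow> f \<omega>' = f \<omega>"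
  by (simp add: nodewise_def)

lemma node_refl [simp]: "\<omega> \<in> node \<X> t \<omega>"
  by (simp add: node_def)

lemma node_eq: "\<omega>' \<in> node \<X> t \<omega> \<Longrightarrow> node \<X> t \<omega>' = node \<X> t \<omega>"
  by (auto simp: node_def)

lemma node_antimono: "s \<le> t \<Longrightarrow> node \<X> t \<omega> \<subseteq> node \<X> s \<omega>"
  by (auto simp: node_def)

lemma nodewise_mono: "s \<le> t \<Longrightarrow> nodewise \<X> s f \<Longrightarrow> nodewise \<X> t f"
  unfolding nodewise_def by (metis node_antimono subsetD)

lemma nodewise_const: "nodewise \<X> t (\<lambda>_. c)"
  by (simp add: nodewise_def)

lemma nodewise_map2:
  assumes "nodewise \<X> t f" "nodewise \<X> t g"
  shows "nodewise \<X> t (\<lambda>\<omega>. h (f \<omega>) (g \<omega>))"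
  unfolding nodewise_def
proof (intro allI impI)
  fix \<omega> \<omega>' assume "\<omega>' \<in> node \<X> t \<omega>"
  then show "h (f \<omega>') (g \<omega>') = h (f \<omega>) (g \<omega>)"
    by (metis nodewiseD assms)
qed

text \<open>The operations and relations that build up the equation, the comparisons and the balance
  condition; a predicate is treated as a truth-valued map.\<close>

lemmas nodewise_intros = nodewise_const
  nodewise_map2[where h = "(+)"] nodewise_map2[where h = "(-)"] nodewise_map2[where h = scalar_prod]
  nodewise_map2[where h = "(=)"] nodewise_map2[where h = "(\<le>)"] nodewise_map2[where h = "(<)"]
  nodewise_map2[where h = "(\<longrightarrow>)"]

lemma nodewise_Suc: "nodewise \<X> t f \<Longrightarrow> nodewise \<X> (Suc t) f"
  by (rule nodewise_mono[of t "Suc t"]) simp_all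

section \<open>Measurable sets and maps in terms of nodes\<close>

lemma space_filt [simp]: "space (filt \<X> t) = UNIV"
  by (simp add: filt_def space_measure_of_conv)

lemma sets_filt: "sets (filt \<X> t) = sigma_sets UNIV {\<X> u -` {v} | u v. 1 \<le> u \<and> u \<le> t}"
  unfolding filt_def by (rule sets_measure_of) simp

lemma space_filt_inf [simp]: "space (filt_inf \<X>) = UNIV"
  by (simp add: filt_inf_def space_measure_of_conv)

lemma filt_le_filt_inf: "sets (filt \<X> t) \<subseteq> sets (filt_inf \<X>)"
proof -
  have "sets (filt_inf \<X>) = sigma_sets UNIV (\<Union>t. sets (filt \<X> t))"
    unfolding filt_inf_def by (rule sets_measure_of) simp
  then show ?thesis by auto
qed

lemma node_in_filt: "node \<X> t \<omega> \<in> sets (filt \<X> t)"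
proof -
  have "node \<X> t \<omega> = space (filt \<X> t) \<inter> (\<Inter>u\<in>{1..t}. \<X> u -` {\<X> u \<omega>})"
    by (auto simp: node_def)
  also have "\<dots> \<in> sets (filt \<X> t)"
  proof (cases "t = 0")
    \<comment> \<open>The index set is empty here, so the intersection is the whole space.\<close>
    case True
    then show ?thesis using sets.top[of "filt \<X> t"] by simp
  next
    case False
    have "\<X> u -` {\<X> u \<omega>} \<in> sets (filt \<X> t)" if "u \<in> {1..t}" for u
      unfolding sets_filt using that by (intro sigma_sets.Basic) auto
    then show ?thesis using False
      by (intro sets.Int sets.top sets.finite_INT) auto
  qed
  finally show ?thesis .
qed

lemma node_in_filt_inf: "node \<X> t \<omega> \<in> sets (filt_inf \<X>)"
  using node_in_filt filt_le_filt_inf by (rule subsetD[rotated])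

text \<open>A generator prescribes one state \<open>\<X> u\<close> with
  \<open>1 \<le> u \<le> t\<close>, so it contains each node or misses it; complements and countable
  unions keep this property.\<close>

lemma nodewise_sets:
  assumes "A \<in> sets (filt \<X> t)"
  shows "nodewise \<X> t (\<lambda>\<omega>. \<omega> \<in> A)"
  using assms unfolding sets_filt
proof (induction rule: sigma_sets.induct)
  case (Basic a)
  then show ?case by (auto simp: nodewise_def node_def)
qed (auto simp: nodewise_def)

text \<open>Points of a T1 space are closed, so the level set of \<open>f\<close> through
  \<open>\<omega>\<close> lies in \<open>filt \<X> t\<close> and contains the node. The class covers
  both \<open>real\<close> and \<open>ereal\<close>.\<close>

lemma nodewise_measurable:
  fixes f :: "'a \<Rightarrow> 'b::t1_space"
  assumes "f \<in> borel_measurable (filt \<X> t)"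
  shows "nodewise \<X> t f"
  unfolding nodewise_def
proof (intro allI impI)
  fix \<omega> \<omega>' assume \<omega>': "\<omega>' \<in> node \<X> t \<omega>"
  have "f -` {f \<omega>} \<in> sets (filt \<X> t)"
    using measurable_sets[OF assms, of "{f \<omega>}"] by simp
  from nodewiseD[OF nodewise_sets[OF this] \<omega>'] show "f \<omega>' = f \<omega>" by simp
qed

lemma nodewise_adapted_vec:
  assumes "adapted_vec \<X> k t z"
  shows "nodewise \<X> t z"
  unfolding nodewise_def
proof (intro allI impI)
  fix \<omega> \<omega>' assume "\<omega>' \<in> node \<X> t \<omega>"
  then show "z \<omega>' = z \<omega>"
    using assms unfolding adapted_vec_def
    by (intro eq_vecI) (metis carrier_vecD nodewiseD nodewise_measurable)+
qed

lemma nodewise_cumul: "nodewise \<X> t (cumul N \<X> t)"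
  by (auto simp: nodewise_def node_def cumul_def intro!: sum.cong eq_vecI)

lemma nodewise_incr:
  assumes "nodewise \<X> t (\<phi> t)"
  shows "nodewise \<X> (Suc t) (incr N \<X> \<phi> t)"
  unfolding incr_def
  by (intro nodewise_map2[where h = mult_mat_vec] nodewise_map2[where h = "(-)"] nodewise_cumul
      assms[THEN nodewise_Suc] nodewise_cumul[THEN nodewise_Suc])

text \<open>Adaptedness is assumed for the stacked matrix \<open>Phi\<close>; this recovers its
  blocks. The common row count \<open>m\<close> fixes where the matrix is cut.\<close>

lemma append_rows_inject:
  assumes "A \<in> carrier_mat m n" "A' \<in> carrier_mat m n" "B \<in> carrier_mat k n" "B' \<in> carrier_mat k n"
    and eq: "A @\<^sub>r B = A' @\<^sub>r B'"
  shows "A = A'" "B = B'"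
proof -
  note index = assms(1-4)[THEN carrier_matD(1)] assms(1-4)[THEN carrier_matD(2)]
  show "A = A'"
  proof (rule eq_matI)
    fix i j assume "i < dim_row A'" "j < dim_col A'"
    with arg_cong[OF eq, of "\<lambda>C. C $$ (i, j)"] show "A $$ (i, j) = A' $$ (i, j)"
      by (simp add: append_rows_def index)
  qed (simp_all add: index)
  show "B = B'"
  proof (rule eq_matI)
    fix i j assume "i < dim_row B'" "j < dim_col B'"
    with arg_cong[OF eq, of "\<lambda>C. C $$ (m + i, j)"] show "B $$ (i, j) = B' $$ (i, j)"
      by (simp add: append_rows_def index)
  qed (simp_all add: index)
qed

section \<open>Finiteness of the tree and its consequences for \<open>H\<close> and
  \<open>E\<close>\<close>

context sl_expectation
begin

text \<open>A node is determined by its first \<open>t\<close> states, which form an element of a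
  finite product. The restriction hides all other times, in particular time \<open>0\<close>, where
  \<open>\<X>\<close> may take any value.\<close>

lemma finite_range_node: "finite (range (node \<X> t))"
proof -
  let ?f = "\<lambda>\<omega>. restrict (\<lambda>u. \<X> u \<omega>) {1..t}"
  have "range ?f \<subseteq> {1..t} \<rightarrow>\<^sub>E set (unit_vecs N)"
    using basis_valued by auto
  then have "finite (range ?f)"
    by (rule finite_subset) (intro finite_PiE, auto)
  moreover have "node \<X> t \<omega> = {\<omega>'. ?f \<omega>' = ?f \<omega>}" for \<omega>
    by (auto simp: node_def restrict_def fun_eq_iff)
  then have "range (node \<X> t) = (\<lambda>g. {\<omega>'. ?f \<omega>' = g}) ` range ?f" by (auto simp: image_iff)
  ultimately show ?thesis by simp
qed

text \<open>The map factors through the finite set of nodes, by way of a chosen member of each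
  node.\<close>

lemma finite_range_nodewise:
  assumes "nodewise \<X> t f"
  shows "finite (range f)"
proof -
  have "f \<omega> = f (SOME \<omega>'. \<omega>' \<in> node \<X> t \<omega>)" for \<omega>
    using nodewiseD[OF assms someI[of "\<lambda>\<omega>'. \<omega>' \<in> node \<X> t \<omega>" \<omega>]] by simp
  then have "range f \<subseteq> (\<lambda>n. f (SOME \<omega>'. \<omega>' \<in> n)) ` range (node \<X> t)" by blast
  then show ?thesis using finite_range_node finite_surj by blast
qed

lemma H_sum: "finite I \<Longrightarrow> (\<And>i. i \<in> I \<Longrightarrow> X i \<in> H) \<Longrightarrow> (\<lambda>\<omega>. \<Sum>i\<in>I. X i \<omega>) \<in> H"
  by (induction I rule: finite_induct) (auto intro: H_const H_add)

lemma indicator_in_H: "A \<in> sets (filt_inf \<X>) \<Longrightarrow> indicat_real A \<in> H"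
  using H_indicator[OF H_const[of 1]] by simp

text \<open>\<open>f\<close> is a finite combination of node indicators, with \<open>?g n\<close>
  its value on the node \<open>n\<close>. This makes \<open>E t\<close> applicable to the
  increments.\<close>

lemma nodewise_in_H:
  assumes f: "nodewise \<X> t f"
  shows "f \<in> H"
proof -
  let ?g = "\<lambda>n. f (SOME \<omega>'. \<omega>' \<in> n)"
  have "f \<omega> = (\<Sum>n\<in>range (node \<X> t). indicat_real n \<omega> * ?g n)" for \<omega>
  proof -
    have "(\<Sum>n\<in>range (node \<X> t). indicat_real n \<omega> * ?g n)
        = (\<Sum>n\<in>range (node \<X> t). if n = node \<X> t \<omega> then ?g n else 0)"
      by (intro sum.cong) (auto simp: indicator_def node_eq)
    also have "\<dots> = ?g (node \<X> t \<omega>)" using finite_range_node by simp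
    also have "\<dots> = f \<omega>"
      by (rule nodewiseD[OF f someI[of "\<lambda>\<omega>'. \<omega>' \<in> node \<X> t \<omega>" \<omega>]]) simp
    finally show ?thesis by simp
  qed
  then have "f = (\<lambda>\<omega>. \<Sum>n\<in>range (node \<X> t). indicat_real n \<omega> * ?g n)" by blast
  also have "\<dots> \<in> H"
  proof (intro H_sum H_indicator H_const finite_range_node)
    fix n assume "n \<in> range (node \<X> t)"
    then show "n \<in> sets (filt_inf \<X>)" using node_in_filt_inf by auto
  qed
  finally show ?thesis .
qed

text \<open>The node is an event of \<open>filt \<X> t\<close>, so its indicator can be pulled out
  of \<open>E t\<close>; at \<open>\<omega>\<close> itself the indicator is
  \<open>1\<close>.\<close>

lemma E_cong_node:
  assumes "X \<in> H" "X' \<in> H" and eq: "\<And>\<omega>'. \<omega>' \<in> node \<X> t \<omega> \<Longrightarrow> X \<omega>' = X' \<omega>'"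
  shows "E t X \<omega> = E t X' \<omega>"
proof -
  let ?I = "indicat_real (node \<X> t \<omega>)"
  have "(\<lambda>\<omega>. ?I \<omega> * X \<omega>) = (\<lambda>\<omega>. ?I \<omega> * X' \<omega>)"
    by (auto simp: indicator_def eq)
  then have "?I \<omega> * E t X \<omega> = ?I \<omega> * E t X' \<omega>"
    using E_local[OF assms(1) node_in_filt[of \<X> t \<omega>]] E_local[OF assms(2) node_in_filt[of \<X> t \<omega>]]
    by metis
  then show ?thesis by simp
qed

section \<open>Polar sets\<close>

lemma polar_empty: "polar \<X> E {}"
proof -
  have "indicat_real ({} :: 'a set) = (\<lambda>_. 0)" by auto
  then show ?thesis
    using E_adapted[of "\<lambda>_. 0" 0] H_const[of 0] by (simp add: polar_def Ht_def)
qed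

lemma polar_subset:
  assumes "polar \<X> E B" "A \<in> sets (filt_inf \<X>)" "A \<subseteq> B"
  shows "polar \<X> E A"
proof -
  have B: "B \<in> sets (filt_inf \<X>)" "E 0 (indicat_real B) = (\<lambda>_. 0)"
    using assms(1) by (auto simp: polar_def)
  have "E 0 (indicat_real A) \<omega> \<le> 0" for \<omega>
    using E_mono[OF indicator_in_H[OF B(1)] indicator_in_H[OF assms(2)], of 0 \<omega>] B(2) assms(3)
    by (auto simp: indicator_def)
  moreover have "0 \<le> E 0 (indicat_real A) \<omega>" for \<omega>
    using E_mono[OF indicator_in_H[OF assms(2)] H_const[of 0], of 0 \<omega>]
      E_adapted[of "\<lambda>_. 0" 0] H_const[of 0]
    by (auto simp: Ht_def)
  ultimately show ?thesis using assms(2) by (auto simp: polar_def intro!: ext antisym)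
qed

lemma polar_Un:
  assumes "polar \<X> E A" "polar \<X> E B"
  shows "polar \<X> E (A \<union> B)"
proof -
  \<comment> \<open>Cutting \<open>B\<close> down to \<open>B - A\<close> makes the indicators add
    up exactly, so that subadditivity applies.\<close>
  have A: "A \<in> sets (filt_inf \<X>)" "E 0 (indicat_real A) = (\<lambda>_. 0)"
    and B: "B - A \<in> sets (filt_inf \<X>)" "E 0 (indicat_real (B - A)) = (\<lambda>_. 0)"
    using assms polar_subset[OF assms(2), of "B - A"] by (auto simp: polar_def)
  have sum: "indicat_real (A \<union> B) = (\<lambda>\<omega>. indicat_real A \<omega> + indicat_real (B - A) \<omega>)"
    by (auto simp: indicator_def)
  have AB: "A \<union> B \<in> sets (filt_inf \<X>)" using sets.Un[OF A(1) B(1)] by simp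
  have "E 0 (indicat_real (A \<union> B)) \<omega> \<le> 0" for \<omega>
    using E_subadd[OF indicator_in_H[OF A(1)] indicator_in_H[OF B(1)], of 0 \<omega>] A(2) B(2)
    by (simp add: sum)
  moreover have "0 \<le> E 0 (indicat_real (A \<union> B)) \<omega>" for \<omega>
    using E_mono[OF indicator_in_H[OF AB] indicator_in_H[OF A(1)], of 0 \<omega>] A(2)
    by (auto simp: indicator_def)
  ultimately show ?thesis using AB by (auto simp: polar_def intro!: ext antisym)
qed

lemma polar_Union: "finite \<A> \<Longrightarrow> (\<And>A. A \<in> \<A> \<Longrightarrow> polar \<X> E A) \<Longrightarrow> polar \<X> E (\<Union>\<A>)"
  by (induction \<A> rule: finite_induct) (auto intro: polar_empty polar_Un)

text \<open>A node is covered by its finitely many descendants at time \<open>t\<close>; if all of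
  them were polar, so would be their union.\<close>

lemma nonpolar_child:
  assumes "\<not> polar \<X> E (node \<X> s \<omega>)" "s \<le> t"
  shows "\<exists>\<omega>'\<in>node \<X> s \<omega>. \<not> polar \<X> E (node \<X> t \<omega>')"
proof (rule ccontr)
  assume "\<not> ?thesis"
  then have "polar \<X> E (\<Union>(node \<X> t ` node \<X> s \<omega>))"
    by (intro polar_Union finite_subset[OF image_mono finite_range_node]) auto
  moreover have "node \<X> s \<omega> \<subseteq> \<Union>(node \<X> t ` node \<X> s \<omega>)" by auto
  ultimately have "polar \<X> E (node \<X> s \<omega>)" by (rule polar_subset[OF _ node_in_filt_inf])
  then show False using assms(1) by simp
qed

lemma nonpolar_parent:
  assumes "\<not> polar \<X> E (node \<X> t \<omega>')" "s \<le> t" "\<omega>' \<in> node \<X> s \<omega>"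
  shows "\<not> polar \<X> E (node \<X> s \<omega>)"
proof
  assume "polar \<X> E (node \<X> s \<omega>)"
  then have "polar \<X> E (node \<X> t \<omega>')"
    using node_antimono[OF assms(2), of \<X> \<omega>'] node_eq[OF assms(3)]
    by (intro polar_subset[OF _ node_in_filt_inf]) simp_all
  then show False using assms(1) by simp
qed

section \<open>Quasi-sure statements and non-polar nodes\<close>

lemma qs_mono: "qs \<X> E P \<Longrightarrow> (\<And>\<omega>. P \<omega> \<Longrightarrow> R \<omega>) \<Longrightarrow> qs \<X> E R"
  unfolding qs_def by blast

lemma qs_conj: "qs \<X> E P \<Longrightarrow> qs \<X> E R \<Longrightarrow> qs \<X> E (\<lambda>\<omega>. P \<omega> \<and> R \<omega>)"
  unfolding qs_def using polar_Un by (metis UnI1 UnI2)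

text \<open>A non-polar node cannot lie inside the exceptional set, so \<open>P\<close> holds
  somewhere in the node and, being constant there, also at \<open>\<omega>\<close>.\<close>

lemma qs_at_node:
  assumes "qs \<X> E P" "nodewise \<X> t P" "\<not> polar \<X> E (node \<X> t \<omega>)"
  shows "P \<omega>"
proof -
  obtain A where A: "polar \<X> E A" "\<And>\<omega>. \<omega> \<notin> A \<Longrightarrow> P \<omega>" using assms(1) by (auto simp: qs_def)
  have "\<not> node \<X> t \<omega> \<subseteq> A"
    using polar_subset[OF A(1) node_in_filt_inf] assms(3) by blast
  then obtain \<omega>' where "\<omega>' \<in> node \<X> t \<omega>" "\<omega>' \<notin> A" by blast
  then show ?thesis using A(2) nodewiseD[OF assms(2)] by blast
qed

text \<open>The way back: the union of the finitely many polar time-\<open>t\<close> nodes serves as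
  exceptional set.\<close>

lemma qs_nodeI:
  assumes "\<And>\<omega>. \<not> polar \<X> E (node \<X> t \<omega>) \<Longrightarrow> P \<omega>"
  shows "qs \<X> E P"
proof -
  let ?A = "\<Union>{n \<in> range (node \<X> t). polar \<X> E n}"
  have "polar \<X> E ?A"
    using finite_range_node by (intro polar_Union) auto
  moreover have "P \<omega>" if "\<omega> \<notin> ?A" for \<omega>
    using assms[of \<omega>] that by (metis (mono_tags, lifting) UnionI mem_Collect_eq node_refl rangeI)
  ultimately show ?thesis unfolding qs_def by blast
qed

text \<open>\<open>Min\<close> is attained on a finite nonempty set: \<open>X\<close> has finitely
  many values, and a non-polar node has a non-polar descendant.\<close>

lemma cond_ess_min_attained:
  assumes X: "nodewise \<X> s X" and "t \<le> s" and "\<not> polar \<X> E (node \<X> t \<omega>)"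
  obtains \<omega>' where "\<omega>' \<in> node \<X> t \<omega>" "\<not> polar \<X> E (node \<X> s \<omega>')"
    "X \<omega>' = cond_ess_min \<X> E t s X \<omega>"
proof -
  let ?S = "{\<omega>' \<in> node \<X> t \<omega>. \<not> polar \<X> E (node \<X> s \<omega>')}"
  have "finite (X ` ?S)"
    using finite_range_nodewise[OF X] by (rule rev_finite_subset) auto
  moreover have "X ` ?S \<noteq> {}" using nonpolar_child[OF assms(3,2)] by auto
  ultimately have "cond_ess_min \<X> E t s X \<omega> \<in> X ` ?S"
    unfolding cond_ess_min_def by (rule Min_in)
  then show ?thesis using that by auto
qed

end

section \<open>The basis increments and the equation at a single node\<close>

context sl_basis
begin

lemma nodewise_phi: "nodewise \<X> u (\<phi>s u)" "nodewise \<X> u (\<phi>' u)"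
proof -
  have dim: "mat 1 N (\<lambda>_. 1) \<in> carrier_mat 1 N"
    "\<phi>s u \<omega> @\<^sub>r \<phi>' u \<omega> \<in> carrier_mat (M + (N - M - 1)) N" for \<omega>
    using carrier_append_rows[OF phis_dim phi'_dim] by auto
  have "\<phi>s u \<omega>' = \<phi>s u \<omega> \<and> \<phi>' u \<omega>' = \<phi>' u \<omega>" if "\<omega>' \<in> node \<X> u \<omega>" for \<omega> \<omega>'
  proof -
    \<comment> \<open>By \<open>M < N\<close> the truncated subtraction is exact, and
      \<open>1 + (M + (N - M - 1)) = N\<close>.\<close>
    have carrier: "Phi N \<phi>s \<phi>' u \<omega> \<in> carrier_mat N N" for \<omega>
      using carrier_append_rows[OF dim(1) dim(2)[of \<omega>]] M_less by (simp add: Phi_def)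
    have "Phi N \<phi>s \<phi>' u \<omega>' = Phi N \<phi>s \<phi>' u \<omega>"
    proof (rule eq_matI)
      fix i j assume "i < dim_row (Phi N \<phi>s \<phi>' u \<omega>)" "j < dim_col (Phi N \<phi>s \<phi>' u \<omega>)"
      then show "Phi N \<phi>s \<phi>' u \<omega>' $$ (i, j) = Phi N \<phi>s \<phi>' u \<omega> $$ (i, j)"
        using nodewiseD[OF nodewise_measurable[OF Phi_adapted] that] carrier[of \<omega>] by auto
    qed (simp_all only: carrier_matD[OF carrier])
    then have "\<phi>s u \<omega>' @\<^sub>r \<phi>' u \<omega>' = \<phi>s u \<omega> @\<^sub>r \<phi>' u \<omega>"
      unfolding Phi_def by (rule append_rows_inject(2)[OF dim(1) dim(1) dim(2) dim(2)])
    then show ?thesis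
      using append_rows_inject[OF phis_dim phis_dim phi'_dim phi'_dim] by blast
  qed
  then show "nodewise \<X> u (\<phi>s u)" "nodewise \<X> u (\<phi>' u)" by (auto simp: nodewise_def)
qed

lemma nodewise_increments:
  "nodewise \<X> (Suc t) (incr N \<X> \<phi>s t)" "nodewise \<X> (Suc t) (incr N \<X> \<phi>' t)"
  by (intro nodewise_incr nodewise_phi)+

lemma incr_carrier:
  "incr N \<X> \<phi>s t \<omega> \<in> carrier_vec M" "incr N \<X> \<phi>' t \<omega> \<in> carrier_vec (N - M - 1)"
proof -
  have "cumul N \<X> (Suc t) \<omega> - cumul N \<X> t \<omega> \<in> carrier_vec N"
    by (simp add: cumul_def)
  then show "incr N \<X> \<phi>s t \<omega> \<in> carrier_vec M" "incr N \<X> \<phi>' t \<omega> \<in> carrier_vec (N - M - 1)"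
    unfolding incr_def by (rule mult_mat_vec_carrier[OF phis_dim] mult_mat_vec_carrier[OF phi'_dim])+
qed

text \<open>Links the random argument \<open>Z' t\<close> in the equation to the constant row
  vectors in the balance condition.\<close>

lemma Gt_const:
  assumes Z': "nodewise \<X> t Z'"
  shows "Gt N \<X> E \<phi>' t Z' \<omega> = Gt N \<X> E \<phi>' t (\<lambda>_. Z' \<omega>) \<omega>"
  unfolding Gt_def
proof (rule E_cong_node)
  show "(\<lambda>\<omega>. scalar_prod (Z' \<omega>) (incr N \<X> \<phi>' t \<omega>)) \<in> H"
    "(\<lambda>\<omega>'. scalar_prod (Z' \<omega>) (incr N \<X> \<phi>' t \<omega>')) \<in> H"
    by (intro nodewise_in_H[of "Suc t"] nodewise_intros nodewise_increments Z'[THEN nodewise_Suc])+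
qed (use nodewiseD[OF Z'] in auto)

lemma nodewise_Gt:
  assumes Z': "nodewise \<X> t Z'"
  shows "nodewise \<X> t (Gt N \<X> E \<phi>' t Z')"
proof -
  have "(\<lambda>\<omega>. scalar_prod (Z' \<omega>) (incr N \<X> \<phi>' t \<omega>)) \<in> H"
    by (intro nodewise_in_H[of "Suc t"] nodewise_intros nodewise_increments Z'[THEN nodewise_Suc])
  from E_maps[OF this, of t] show ?thesis
    unfolding Gt_def Ht_def by (auto intro: nodewise_measurable)
qed

lemma nodewise_driver:
  assumes "is_driver N \<X> H E M T F" "t < T" "z \<in> carrier_vec M" "z' \<in> carrier_vec (N - M - 1)"
  shows "nodewise \<X> t (\<lambda>\<omega>. F \<omega> t y z z')"
proof -
  have "(\<lambda>\<omega>. ereal (F \<omega> t y z z')) \<in> borel_measurable (filt \<X> t)"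
    using assms unfolding is_driver_def L1t_def by blast
  then show ?thesis using nodewise_measurable[of _ \<X> t] by (force simp: nodewise_def)
qed

text \<open>All time-\<open>t\<close> quantities are moved from the child \<open>\<omega>'\<close>
  to the reference point \<open>\<omega>\<close>, so on the right-hand side only the increments vary
  from child to child.\<close>

lemma solution_step:
  assumes sol: "is_solution N \<X> E M \<phi>s \<phi>' T F Q Y Z Z'" and F: "is_driver N \<X> H E M T F"
    and t: "t < T" and \<omega>': "\<omega>' \<in> node \<X> t \<omega>" and np: "\<not> polar \<X> E (node \<X> (Suc t) \<omega>')"
  shows "Y (Suc t) \<omega>' = Y t \<omega> - F \<omega> t (Y t \<omega>) (Z t \<omega>) (Z' t \<omega>)
    + scalar_prod (Z t \<omega>) (incr N \<X> \<phi>s t \<omega>') + scalar_prod (Z' t \<omega>) (incr N \<X> \<phi>' t \<omega>')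
    - Gt N \<X> E \<phi>' t (\<lambda>_. Z' t \<omega>) \<omega>"
proof -
  let ?F = "\<lambda>\<omega>. F \<omega> t (Y t \<omega>) (Z t \<omega>) (Z' t \<omega>)"
  have Y: "nodewise \<X> t (Y t)" "nodewise \<X> (Suc t) (Y (Suc t))"
    and Z: "nodewise \<X> t (Z t)" and Z': "nodewise \<X> t (Z' t)"
    and carrier: "Z t \<omega> \<in> carrier_vec M" "Z' t \<omega> \<in> carrier_vec (N - M - 1)" for \<omega>
    using sol t nodewise_measurable[of "Y _" \<X>] nodewise_adapted_vec[of \<X> _ t]
    unfolding is_solution_def by (fastforce, fastforce, blast, blast, auto simp: adapted_vec_def)
  \<comment> \<open>A driver is adapted for fixed arguments. The random arguments are constant on
    the node, so they may be fixed at their values at \<open>\<omega>\<close>.\<close>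
  have F_node: "nodewise \<X> t ?F"
    unfolding nodewise_def
  proof (intro allI impI)
    fix \<omega> \<omega>' assume \<omega>': "\<omega>' \<in> node \<X> t \<omega>"
    show "?F \<omega>' = ?F \<omega>"
      using nodewiseD[OF nodewise_driver[OF F t carrier[of \<omega>]] \<omega>', of "Y t \<omega>"]
      by (simp only: nodewiseD[OF Y(1) \<omega>'] nodewiseD[OF Z \<omega>'] nodewiseD[OF Z' \<omega>'])
  qed
  let ?P = "\<lambda>\<omega>. Y (Suc t) \<omega> = Y t \<omega> - ?F \<omega> + scalar_prod (Z t \<omega>) (incr N \<X> \<phi>s t \<omega>)
    + scalar_prod (Z' t \<omega>) (incr N \<X> \<phi>' t \<omega>) - Gt N \<X> E \<phi>' t (Z' t) \<omega>"
  \<comment> \<open>The left-hand side and the increments are known only at time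
    \<open>Suc t\<close>, so the equation is evaluated at nodes of that time.\<close>
  have "nodewise \<X> (Suc t) ?P"
    by (intro nodewise_intros Y(2) nodewise_increments Y(1)[THEN nodewise_Suc]
        Z[THEN nodewise_Suc] Z'[THEN nodewise_Suc] F_node[THEN nodewise_Suc]
        nodewise_Gt[OF Z', THEN nodewise_Suc])
  moreover have "qs \<X> E ?P" using sol t unfolding is_solution_def by blast
  ultimately have "?P \<omega>'" using qs_at_node np by blast
  then show ?thesis
    using nodewiseD[OF Y(1) \<omega>'] nodewiseD[OF Z \<omega>'] nodewiseD[OF Z' \<omega>'] nodewiseD[OF F_node \<omega>']
      nodewiseD[OF nodewise_Gt[OF Z'] \<omega>'] Gt_const[OF Z'] by simp
qed

text \<open>The point enters only through its time-\<open>t\<close> node.\<close>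

lemma nodewise_cond_ess_min: "nodewise \<X> t (cond_ess_min \<X> E t s X)"
  by (auto simp: nodewise_def cond_ess_min_def node_eq)

end

section \<open>Backward comparison and forward propagation of equality\<close>

theorem theorem6p2:
  fixes N M T :: nat
    and \<X> :: "nat \<Rightarrow> 'a \<Rightarrow> real vec"
    and H :: "('a \<Rightarrow> real) set"
    and E :: "nat \<Rightarrow> ('a \<Rightarrow> real) \<Rightarrow> 'a \<Rightarrow> real"
    and \<phi>s \<phi>' :: "nat \<Rightarrow> 'a \<Rightarrow> real mat"
    and F Fb :: "'a driver"
    and Q Qb :: "'a \<Rightarrow> ereal"
    and Y Yb :: "nat \<Rightarrow> 'a \<Rightarrow> real"
    and Z Zb Z' Zb' :: "nat \<Rightarrow> 'a \<Rightarrow> real vec"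
  assumes basis: "sl_basis N \<X> H E M \<phi>s \<phi>'"
    and Q: "Q \<in> L1t \<X> H E T"
    and Qb: "Qb \<in> L1t \<X> H E T"
    and F: "is_driver N \<X> H E M T F"
    and Fb: "is_driver N \<X> H E M T Fb"
    and sol: "is_solution N \<X> E M \<phi>s \<phi>' T F Q Y Z Z'"
    and solb: "is_solution N \<X> E M \<phi>s \<phi>' T Fb Qb Yb Zb Zb'"
    and terminal_ge: "qs \<X> E (\<lambda>\<omega>. Q \<omega> \<ge> Qb \<omega>)"
    and driver_ge: "\<And>t y z z'. t < T \<Longrightarrow> z \<in> carrier_vec M \<Longrightarrow> z' \<in> carrier_vec (N - M - 1) \<Longrightarrow>
          qs \<X> E (\<lambda>\<omega>. F \<omega> t y z z' \<ge> Fb \<omega> t y z z')"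
    and increasing: "\<And>t z z'. t < T \<Longrightarrow> z \<in> carrier_vec M \<Longrightarrow> z' \<in> carrier_vec (N - M - 1) \<Longrightarrow>
          qs \<X> E (\<lambda>\<omega>. strict_mono (\<lambda>y. y - F \<omega> t y z z'))"
    and balance: "\<And>t y z z' zb zb'. t < T \<Longrightarrow>
          z \<in> carrier_vec M \<Longrightarrow> zb \<in> carrier_vec M \<Longrightarrow>
          z' \<in> carrier_vec (N - M - 1) \<Longrightarrow> zb' \<in> carrier_vec (N - M - 1) \<Longrightarrow>
          (z, z') \<noteq> (zb, zb') \<Longrightarrow>
          qs \<X> E (\<lambda>\<omega>. F \<omega> t y z z' - F \<omega> t y zb zb'
              + Gt N \<X> E \<phi>' t (\<lambda>_. z') \<omega> - Gt N \<X> E \<phi>' t (\<lambda>_. zb') \<omega>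
            > cond_ess_min \<X> E t (Suc t)
                (\<lambda>\<omega>'. scalar_prod (z - zb) (incr N \<X> \<phi>s t \<omega>')
                      + scalar_prod (z' - zb') (incr N \<X> \<phi>' t \<omega>')) \<omega>)"
  shows "(\<forall>t\<le>T. qs \<X> E (\<lambda>\<omega>. Y t \<omega> \<ge> Yb t \<omega>)) \<and>
    (\<forall>t\<le>T. \<forall>A\<in>sets (filt \<X> t).
       qs \<X> E (\<lambda>\<omega>. \<omega> \<in> A \<longrightarrow> Y t \<omega> = Yb t \<omega>) \<longrightarrow> qs \<X> E (\<lambda>\<omega>. \<omega> \<in> A \<longrightarrow> Q \<omega> = Qb \<omega>))"
proof -
  interpret sl_basis N \<X> H E M \<phi>s \<phi>' by (rule basis)
  have nodewise_Y: "nodewise \<X> t (Y t)" "nodewise \<X> t (Yb t)" if "t \<le> T" for t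
    using sol solb that unfolding is_solution_def by (auto intro: nodewise_measurable)
  have carrier: "Z t \<omega> \<in> carrier_vec M" "Z' t \<omega> \<in> carrier_vec (N - M - 1)"
    "Zb t \<omega> \<in> carrier_vec M" "Zb' t \<omega> \<in> carrier_vec (N - M - 1)" if "t < T" for t \<omega>
    using sol solb that unfolding is_solution_def adapted_vec_def by auto
  \<comment> \<open>The first conjunct drives the backward induction for the comparison, the second
    the forward induction for strictness.\<close>
  have one_step: "Y t \<omega> \<ge> Yb t \<omega> \<and> (Y t \<omega> = Yb t \<omega> \<longrightarrow>
      (\<forall>\<omega>'\<in>node \<X> t \<omega>. \<not> polar \<X> E (node \<X> (Suc t) \<omega>') \<longrightarrow> Y (Suc t) \<omega>' = Yb (Suc t) \<omega>'))"
    if t: "t < T" and np: "\<not> polar \<X> E (node \<X> t \<omega>)"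
      and ge: "qs \<X> E (\<lambda>\<omega>. Y (Suc t) \<omega> \<ge> Yb (Suc t) \<omega>)" for t \<omega>
  proof -
    \<comment> \<open>Freezing the solutions at the node gives deterministic arguments, as the
      hypotheses on the drivers require.\<close>
    define y z z' yb zb zb' where vars: "y = Y t \<omega>" "z = Z t \<omega>" "z' = Z' t \<omega>"
      "yb = Yb t \<omega>" "zb = Zb t \<omega>" "zb' = Zb' t \<omega>"
    define D where "D \<omega>' = scalar_prod (z - zb) (incr N \<X> \<phi>s t \<omega>')
      + scalar_prod (z' - zb') (incr N \<X> \<phi>' t \<omega>')" for \<omega>'
    define G where "G v = Gt N \<X> E \<phi>' t (\<lambda>_. v) \<omega>" for v
    have c: "z \<in> carrier_vec M" "z' \<in> carrier_vec (N - M - 1)"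
      "zb \<in> carrier_vec M" "zb' \<in> carrier_vec (N - M - 1)"
      using carrier[OF t] by (simp_all add: vars)
    have D_node: "nodewise \<X> (Suc t) D"
      unfolding D_def by (intro nodewise_intros nodewise_increments)
    have diff: "Y (Suc t) \<omega>' - Yb (Suc t) \<omega>'
        = y - F \<omega> t y z z' - (yb - Fb \<omega> t yb zb zb') + D \<omega>' - G z' + G zb'"
      if "\<omega>' \<in> node \<X> t \<omega>" "\<not> polar \<X> E (node \<X> (Suc t) \<omega>')" for \<omega>'
    proof -
      have "D \<omega>' = scalar_prod z (incr N \<X> \<phi>s t \<omega>') - scalar_prod zb (incr N \<X> \<phi>s t \<omega>')
          + (scalar_prod z' (incr N \<X> \<phi>' t \<omega>') - scalar_prod zb' (incr N \<X> \<phi>' t \<omega>'))"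
        unfolding D_def using c incr_carrier[of t \<omega>'] by (simp add: minus_scalar_prod_distrib)
      then show ?thesis
        using solution_step[OF sol F t that, folded vars G_def]
          solution_step[OF solb Fb t that, folded vars G_def]
        by linarith
    qed
    have ge': "Yb (Suc t) \<omega>' \<le> Y (Suc t) \<omega>'" if "\<not> polar \<X> E (node \<X> (Suc t) \<omega>')" for \<omega>'
      using t by (intro qs_at_node[OF ge _ that] nodewise_intros nodewise_Y) simp_all
    have nF: "nodewise \<X> t (\<lambda>\<omega>. F \<omega> t y z z')" "nodewise \<X> t (\<lambda>\<omega>. Fb \<omega> t y z z')"
      if "z \<in> carrier_vec M" "z' \<in> carrier_vec (N - M - 1)" for y z z'
      using nodewise_driver[OF F t that] nodewise_driver[OF Fb t that] by auto
    \<comment> \<open>The drivers are compared at the barred arguments, where the second equation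
      evaluates \<open>Fb\<close>; this puts \<open>F\<close> in place of \<open>Fb\<close> in
      \<open>diff\<close>.\<close>
    have F_ge: "Fb \<omega> t yb zb zb' \<le> F \<omega> t yb zb zb'"
      by (rule qs_at_node[OF driver_ge[OF t c(3,4)] _ np]) (intro nodewise_intros nF c)
    have incr: "strict_mono (\<lambda>y. y - F \<omega> t y z z')"
    proof (rule qs_at_node[OF increasing[OF t c(1,2)] _ np])
      show "nodewise \<X> t (\<lambda>\<omega>. strict_mono (\<lambda>y. y - F \<omega> t y z z'))"
        unfolding nodewise_def
      proof (intro allI impI)
        fix \<omega> \<omega>' assume \<omega>': "\<omega>' \<in> node \<X> t \<omega>"
        show "strict_mono (\<lambda>y. y - F \<omega>' t y z z') = strict_mono (\<lambda>y. y - F \<omega> t y z z')"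
          by (simp only: nodewiseD[OF nF(1)[OF c(1,2)] \<omega>'])
      qed
    qed
    \<comment> \<open>With \<open>yb\<close> as the common value of \<open>y\<close>, adding this to
      \<open>min\<close> below cancels the driver at \<open>zb\<close>, \<open>zb'\<close> and the
      terms in \<open>G\<close>.\<close>
    have bal: "F \<omega> t yb z z' - F \<omega> t yb zb zb' + G z' - G zb' > cond_ess_min \<X> E t (Suc t) D \<omega>"
      if "(z, z') \<noteq> (zb, zb')"
      unfolding G_def
    proof (rule qs_at_node[OF balance[OF t c(1,3,2,4) that, folded D_def] _ np])
      show "nodewise \<X> t (\<lambda>\<omega>. cond_ess_min \<X> E t (Suc t) D \<omega>
          < F \<omega> t yb z z' - F \<omega> t yb zb zb'
            + Gt N \<X> E \<phi>' t (\<lambda>_. z') \<omega> - Gt N \<X> E \<phi>' t (\<lambda>_. zb') \<omega>)"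
        by (intro nodewise_intros nF c nodewise_Gt nodewise_cond_ess_min)
    qed
    obtain \<omega>m where m: "\<omega>m \<in> node \<X> t \<omega>" "\<not> polar \<X> E (node \<X> (Suc t) \<omega>m)"
      "D \<omega>m = cond_ess_min \<X> E t (Suc t) D \<omega>"
      using cond_ess_min_attained[OF D_node _ np] by auto
    have min: "0 \<le> y - F \<omega> t y z z' - (yb - F \<omega> t yb zb zb') + D \<omega>m - G z' + G zb'"
      using diff[OF m(1,2)] ge'[OF m(2)] F_ge by simp
    have D0: "D \<omega>' = 0" if "(z, z') = (zb, zb')" for \<omega>'
      using that c incr_carrier[of t \<omega>'] by (simp add: D_def minus_scalar_prod_distrib)
    \<comment> \<open>For equal pairs \<open>D\<close> and the difference of the \<open>G\<close>
      terms vanish and \<open>min\<close> is the claim; otherwise \<open>bal\<close> is added, and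
      the inequality is even strict.\<close>
    have "yb - F \<omega> t yb z z' \<le> y - F \<omega> t y z z'"
      using min bal D0[of \<omega>m] m(3) by (cases "(z, z') = (zb, zb')") auto
    then have "yb \<le> y" using strict_mono_less_eq[OF incr] by simp
    moreover have "Y (Suc t) \<omega>' = Yb (Suc t) \<omega>'"
      if "y = yb" "\<omega>' \<in> node \<X> t \<omega>" "\<not> polar \<X> E (node \<X> (Suc t) \<omega>')" for \<omega>'
    proof -
      \<comment> \<open>For distinct pairs and \<open>y = yb\<close>, \<open>min\<close> and
        \<open>bal\<close> would add up to \<open>0 < 0\<close>.\<close>
      have "(z, z') = (zb, zb')" using min bal m(3) that(1) by fastforce
      \<comment> \<open>Now \<open>diff\<close> reduces to \<open>Fb - F\<close>, which is at most
        \<open>0\<close> by \<open>F_ge\<close>, while \<open>ge'\<close> gives the other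
        sign.\<close>
      then show ?thesis
        using diff[OF that(2,3)] ge'[OF that(3)] F_ge D0[of \<omega>'] that(1) by simp
    qed
    ultimately show ?thesis by (simp add: vars)
  qed
  have ge: "qs \<X> E (\<lambda>\<omega>. Y t \<omega> \<ge> Yb t \<omega>)" if "t \<le> T" for t
    using that
  proof (induction t rule: inc_induct)
    case base
    have "qs \<X> E (\<lambda>\<omega>. ereal (Y T \<omega>) = Q \<omega>)" "qs \<X> E (\<lambda>\<omega>. ereal (Yb T \<omega>) = Qb \<omega>)"
      using sol solb by (auto simp: is_solution_def)
    from qs_conj[OF terminal_ge qs_conj[OF this]] show ?case
      by (rule qs_mono) (metis ereal_less_eq(3))
  next
    case (step t)
    then show ?case using one_step by (intro qs_nodeI[of t]) auto
  qed
  moreover have "qs \<X> E (\<lambda>\<omega>. \<omega> \<in> A \<longrightarrow> Q \<omega> = Qb \<omega>)"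
    if t: "t \<le> T" and A: "A \<in> sets (filt \<X> t)" and eq: "qs \<X> E (\<lambda>\<omega>. \<omega> \<in> A \<longrightarrow> Y t \<omega> = Yb t \<omega>)"
    for t A
  proof -
    \<comment> \<open>Forward induction from \<open>t\<close> to \<open>T\<close>, passing equality
      on \<open>A\<close> from each node to its non-polar children.\<close>
    have "qs \<X> E (\<lambda>\<omega>. \<omega> \<in> A \<longrightarrow> Y s \<omega> = Yb s \<omega>)" if "t \<le> s" "s \<le> T" for s
      using that
    proof (induction s rule: dec_induct)
      case (step s)
      then have s: "s < T" and IH: "qs \<X> E (\<lambda>\<omega>. \<omega> \<in> A \<longrightarrow> Y s \<omega> = Yb s \<omega>)" by auto
      \<comment> \<open>Since \<open>t \<le> s\<close>, the event \<open>A\<close> is also a union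
        of time-\<open>s\<close> nodes.\<close>
      have nA: "nodewise \<X> s (\<lambda>\<omega>. \<omega> \<in> A \<longrightarrow> Y s \<omega> = Yb s \<omega>)"
        using nodewise_mono[OF step.hyps(1) nodewise_sets[OF A]] s
        by (intro nodewise_intros nodewise_Y) simp_all
      show ?case
      proof (rule qs_nodeI[of "Suc s"], rule impI)
        fix \<omega> assume np: "\<not> polar \<X> E (node \<X> (Suc s) \<omega>)" and "\<omega> \<in> A"
        have np': "\<not> polar \<X> E (node \<X> s \<omega>)" using nonpolar_parent[OF np] by simp
        then have "Y s \<omega> = Yb s \<omega>" using qs_at_node[OF IH nA] \<open>\<omega> \<in> A\<close> by blast
        \<comment> \<open>The point \<open>\<omega>\<close> serves both as reference point of the
          parent node and as the child.\<close>
        then show "Y (Suc s) \<omega> = Yb (Suc s) \<omega>"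
          using one_step[of s \<omega>] np np' ge[of "Suc s"] s by simp
      qed
    qed (rule eq)
    from this[OF t order_refl] have "qs \<X> E (\<lambda>\<omega>. \<omega> \<in> A \<longrightarrow> Y T \<omega> = Yb T \<omega>)" .
    moreover have "qs \<X> E (\<lambda>\<omega>. ereal (Y T \<omega>) = Q \<omega>)" "qs \<X> E (\<lambda>\<omega>. ereal (Yb T \<omega>) = Qb \<omega>)"
      using sol solb by (auto simp: is_solution_def)
    ultimately have "qs \<X> E (\<lambda>\<omega>. (\<omega> \<in> A \<longrightarrow> Y T \<omega> = Yb T \<omega>) \<and>
        ereal (Y T \<omega>) = Q \<omega> \<and> ereal (Yb T \<omega>) = Qb \<omega>)"
      by (intro qs_conj)
    then show ?thesis by (rule qs_mono) auto
  qed
  ultimately show ?thesis by blast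
qed

end
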